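(* Let $n \geq 1$, let $A_1,\ldots,A_n$ be sets of positive integers (not necessarily distinct), let $g$ be a positive integer and let $\gamma$ be a real number. For $r = 1,\ldots,n$ and each positive integer $m$ let $$\phi_r(m) = \sum_{I} S_I(m),$$ where the sum runs over all $r$-element subsets $I = \{i_1,\ldots,i_r\}$ of $\{1,\ldots,n\}$ and $S_I = A_{i_1} + \cdots + A_{i_r}$. If $\phi_1(m) \geq \gamma m$ for all $m = 1,\ldots,g$, then $$\phi_r(m) \geq \binom{n-1}{r-1}\min(1,\gamma)\, m$$ for all $m = 1,\ldots,g$ and all $r = 1,\ldots,n$.
   Context: For sets $A_1,\ldots,A_h$ of positive integers, the sumset $A_1+\cdots+A_h$ is the set of all integers of the form $a_1+\cdots+a_h$ with $a_i \in A_i \cup \{0\}$ for each $i$. For a set $X$ of integers, the counting function is $X(x) = |\{a \in X : 1 \leq a \leq x\}|$. Thus $\phi_1(m) = A_1(m)+\cdots+A_n(m)$. *)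

theory Defs
  imports Complex_Main
begin

text \<open>Positive integers are represented as nonzero elements of \<^typ>\<open>nat\<close>. The sumset of a
  family \<open>A\<close> over a finite index set \<open>I\<close> adjoins 0 to every summand.\<close>

definition sumset :: "('i \<Rightarrow> nat set) \<Rightarrow> 'i set \<Rightarrow> nat set" where
  "sumset A I = {\<Sum>i\<in>I. a i | a. \<forall>i\<in>I. a i \<in> A i \<union> {0}}"

definition counting :: "nat set \<Rightarrow> nat \<Rightarrow> nat" where
  "counting X x = card {a \<in> X. 1 \<le> a \<and> a \<le> x}"

definition phi :: "(nat \<Rightarrow> nat set) \<Rightarrow> nat \<Rightarrow> nat \<Rightarrow> nat \<Rightarrow> nat" where
  "phi A n r m = (\<Sum>I | I \<subseteq> {1..n} \<and> card I = r. counting (sumset A I) m)"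

end

theory Submission
  imports Defs "HOL-Combinatorics.Transposition"
begin

text \<open>
  Dyson's transform. Adjoin 0 to every set, truncate all sets at \<open>g\<close>, and fix one index \<open>p\<close>. As long as
  some \<open>A\<^sub>j\<close> with \<open>j \<noteq> p\<close> has a positive element, let \<open>e\<close> be the least element of \<open>A\<^sub>p\<close> with
  \<open>e + b \<notin> A\<^sub>p\<close> for some \<open>b \<in> A\<^sub>j\<close>, \<open>j \<noteq> p\<close>, and move every \<open>b \<in> A\<^sub>j\<close> with \<open>e + b \<notin> A\<^sub>p\<close> to the element
  \<open>e + b\<close> of \<open>A\<^sub>p\<close>. No \<open>\<phi>\<^sub>r\<close> increases: sumsets over index sets that contain both or neither of \<open>p\<close>, \<open>j\<close> do not
  grow, and an element that is new in \<open>A\<^sub>p + S\<close> comes from a lost element of \<open>A\<^sub>j + S\<close> that is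
  smaller by \<open>e\<close>. The minimality of \<open>e\<close> preserves the hypothesis \<open>\<phi>\<^sub>1(m) \<ge> \<gamma> m\<close>. In the end all sets
  except \<open>A\<^sub>p\<close> are \<open>{0}\<close>, and \<open>\<phi>\<^sub>r\<close> is exactly \<open>(n - 1 choose r - 1) \<phi>\<^sub>1\<close>.
\<close>

section \<open>Rank sums over a finite index set, and the transform\<close>

definition rank_sum :: "('i \<Rightarrow> nat set) \<Rightarrow> 'i set \<Rightarrow> nat \<Rightarrow> nat \<Rightarrow> nat" where
  "rank_sum B J r m = (\<Sum>I | I \<subseteq> J \<and> card I = r. counting (sumset B I) m)"

text \<open>All of \<open>e + B j\<close> may be joined to \<open>B p\<close>: for the elements
  \<open>b\<close> that stay in \<open>B j\<close>, the sum \<open>e + b\<close> lies in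
  \<open>B p\<close> already, so only the moved elements are new. Both updates refer to the old
  \<open>B\<close>.\<close>

definition dyson_transform :: "'i \<Rightarrow> 'i \<Rightarrow> nat \<Rightarrow> ('i \<Rightarrow> nat set) \<Rightarrow> 'i \<Rightarrow> nat set" where
  "dyson_transform p j e B = B(p := B p \<union> (+) e ` B j, j := {b \<in> B j. e + b \<in> B p})"

section \<open>Counting functions\<close>

lemma finite_counting [simp]: "finite {a \<in> X. 1 \<le> a \<and> a \<le> (m::nat)}"
  by (rule finite_subset[of _ "{..m}"]) auto

lemma counting_mono: "X \<inter> {1..m} \<subseteq> Y \<Longrightarrow> counting X m \<le> counting Y m"
  unfolding counting_def by (rule card_mono) auto

lemma counting_mono_bound: "k \<le> m \<Longrightarrow> counting X k \<le> counting X m"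
  unfolding counting_def by (rule card_mono) auto

lemma counting_cong: "X \<inter> {1..m} = Y \<inter> {1..m} \<Longrightarrow> counting X m = counting Y m"
  by (rule antisym) (rule counting_mono; blast)+

lemma counting_Diff: "Y' \<subseteq> Y \<Longrightarrow> counting Y m = counting Y' m + counting (Y - Y') m"
  unfolding counting_def by (subst card_Un_disjoint[symmetric]) (auto intro!: arg_cong[of _ _ card])

text \<open>Subtracting \<open>e\<close> injects the elements new in \<open>X'\<close> into those
  lost from \<open>Y\<close>. As \<open>0\<close> is in \<open>Y'\<close>, these differences are
  positive and hence counted.\<close>

lemma counting_exchange:
  assumes "Y' \<subseteq> Y" "0 \<in> Y'" and shift: "\<And>x. x \<in> X' - X \<Longrightarrow> e \<le> x \<and> x - e \<in> Y - Y'"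
  shows "counting X' m + counting Y' m \<le> counting X m + counting Y m"
proof -
  have "counting X' m \<le> counting (X \<union> X') m" by (rule counting_mono) auto
  also have "\<dots> = counting X m + counting (X' - X) m"
    using counting_Diff[of X "X \<union> X'" m] by (simp add: Un_Diff)
  also have "counting (X' - X) m \<le> counting (Y - Y') m"
    unfolding counting_def
  proof (rule card_inj_on_le[where f = "\<lambda>x. x - e"])
    show "inj_on (\<lambda>x. x - e) {a \<in> X' - X. 1 \<le> a \<and> a \<le> m}"
      using shift by (intro inj_onI) (metis (lifting) le_add_diff_inverse2 mem_Collect_eq)
    have "1 \<le> x - e" if "x \<in> X' - X" for x
      using shift[OF that] assms(2) by (cases "x - e = 0") auto
    then show "(\<lambda>x. x - e) ` {a \<in> X' - X. 1 \<le> a \<and> a \<le> m} \<subseteq> {a \<in> Y - Y'. 1 \<le> a \<and> a \<le> m}"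
      using shift by fastforce
  qed simp
  finally show ?thesis
    using counting_Diff[OF assms(1), of m] by simp
qed

text \<open>The translates by \<open>b\<close> of \<open>0\<close> and of the elements of
  \<open>X\<close> up to \<open>t\<close> lie between \<open>b\<close> and \<open>b + t\<close>,
  beyond all that is counted up to \<open>b - 1\<close>. The summand 1 stands for \<open>b\<close>,
  the translate of \<open>0\<close>.\<close>

lemma counting_superadd:
  assumes "0 < b" "\<And>a. a \<in> X \<Longrightarrow> a \<le> t \<Longrightarrow> a + b \<in> X" "0 \<in> X"
  shows "counting X (b - 1) + 1 + counting X t \<le> counting X (b + t)"
proof -
  have "b \<in> X" using assms(2)[of 0] assms(3) by simp
  let ?T = "insert 0 {a \<in> X. 1 \<le> a \<and> a \<le> t}"
  have "counting X (b - 1) + 1 + counting X t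
      = card {a \<in> X. 1 \<le> a \<and> a \<le> b - 1} + card ((+) b ` ?T)"
    unfolding counting_def by (subst card_image) auto
  also have "\<dots> = card ({a \<in> X. 1 \<le> a \<and> a \<le> b - 1} \<union> (+) b ` ?T)"
    using assms(1) by (subst card_Un_disjoint) auto
  also have "\<dots> \<le> counting X (b + t)"
    unfolding counting_def using assms \<open>b \<in> X\<close> by (intro card_mono) (auto simp: add.commute)
  finally show ?thesis .
qed

section \<open>Sumsets\<close>

lemma zero_in_sumset: "0 \<in> sumset B I"
  unfolding sumset_def by (auto intro!: exI[of _ "\<lambda>_. 0"])

lemma sumset_cong: "(\<And>i. i \<in> I \<Longrightarrow> B i = C i) \<Longrightarrow> sumset B I = sumset C I"
  unfolding sumset_def by auto

lemma sumset_insert: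
  assumes "finite K" "i \<notin> K" "0 \<in> B i"
  shows "sumset B (insert i K) = {x + y | x y. x \<in> B i \<and> y \<in> sumset B K}"
proof (intro equalityI subsetI)
  fix z assume "z \<in> sumset B (insert i K)"
  then show "z \<in> {x + y | x y. x \<in> B i \<and> y \<in> sumset B K}"
    using assms unfolding sumset_def by fastforce
next
  fix z assume "z \<in> {x + y | x y. x \<in> B i \<and> y \<in> sumset B K}"
  then obtain x a where z: "z = x + (\<Sum>k\<in>K. a k)" "x \<in> B i" "\<forall>k\<in>K. a k \<in> B k \<union> {0}"
    unfolding sumset_def by auto
  have "(\<Sum>k\<in>K. (a(i := x)) k) = (\<Sum>k\<in>K. a k)"
    using assms(2) by (intro sum.cong) auto
  then have "z = (\<Sum>k\<in>insert i K. (a(i := x)) k)"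
    using z(1) assms by simp
  moreover have "\<forall>k\<in>insert i K. (a(i := x)) k \<in> B k \<union> {0}"
    using z assms(2) by auto
  ultimately show "z \<in> sumset B (insert i K)"
    unfolding sumset_def by blast
qed

section \<open>The transform does not increase rank sums\<close>

text \<open>A moved element \<open>e + b\<close> and a surviving \<open>y\<close> of
  \<open>B j\<close> trade places: \<open>(e + b) + y = (e + y) + b\<close>, and
  \<open>e + y\<close> is in \<open>B p\<close> because \<open>y\<close> survived.\<close>

lemma sumset_dyson_transform_both:
  assumes "finite K" "p \<notin> K" "j \<notin> K" "p \<noteq> j" "0 \<in> B p" "0 \<in> B j" "e \<in> B p"
  shows "sumset (dyson_transform p j e B) (insert p (insert j K)) \<subseteq> sumset B (insert p (insert j K))"
proof
  let ?B = "dyson_transform p j e B"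
  have eqK: "sumset ?B K = sumset B K"
    using assms by (intro sumset_cong) (auto simp: dyson_transform_def)
  have "0 \<in> ?B p" "0 \<in> ?B j" using assms by (auto simp: dyson_transform_def)
  then have S: "sumset ?B (insert p (insert j K))
      = {x + y | x y. x \<in> ?B p \<and> y \<in> {x + y | x y. x \<in> ?B j \<and> y \<in> sumset B K}}"
    using assms by (simp add: sumset_insert eqK)
  fix z assume "z \<in> sumset ?B (insert p (insert j K))"
  then obtain x y s where z: "z = x + (y + s)" "x \<in> ?B p" "y \<in> ?B j" "s \<in> sumset B K"
    unfolding S by blast
  have "\<exists>x' y'. z = x' + (y' + s) \<and> x' \<in> B p \<and> y' \<in> B j"
  proof (cases "x \<in> B p")
    case True
    with z assms show ?thesis by (auto simp: dyson_transform_def)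
  next
    case False
    with z assms obtain b where "b \<in> B j" "x = e + b" by (auto simp: dyson_transform_def)
    with z assms show ?thesis
      by (intro exI[of _ "e + y"] exI[of _ b]) (auto simp: dyson_transform_def)
  qed
  with z(4) assms show "z \<in> sumset B (insert p (insert j K))"
    by (auto simp: sumset_insert)
qed

text \<open>A new sum \<open>z = (e + b) + s\<close> on the side of \<open>p\<close> is charged to
  \<open>z - e = b + s\<close> on the side of \<open>j\<close>. That sum is lost there: were it
  still \<open>b' + s'\<close> with \<open>b'\<close> surviving, then
  \<open>z = (e + b') + s'\<close> would be an old sum.\<close>

lemma counting_dyson_transform_one:
  assumes "finite K" "p \<notin> K" "j \<notin> K" "p \<noteq> j" "0 \<in> B p" "0 \<in> B j" "e \<in> B p"
  defines "C \<equiv> dyson_transform p j e B"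
  shows "counting (sumset C (insert p K)) m + counting (sumset C (insert j K)) m
       \<le> counting (sumset B (insert p K)) m + counting (sumset B (insert j K)) m"
proof (rule counting_exchange[where e = e])
  have eqK: "sumset C K = sumset B K"
    using assms by (intro sumset_cong) (auto simp: dyson_transform_def C_def)
  have Cp: "C p = B p \<union> (+) e ` B j" and Cj: "C j = {b \<in> B j. e + b \<in> B p}"
    using assms(4) by (auto simp: dyson_transform_def C_def)
  have Sp: "sumset C (insert p K) = {x + y | x y. x \<in> C p \<and> y \<in> sumset B K}"
    and Sj: "sumset C (insert j K) = {x + y | x y. x \<in> C j \<and> y \<in> sumset B K}"
    and Tp: "sumset B (insert p K) = {x + y | x y. x \<in> B p \<and> y \<in> sumset B K}"
    and Tj: "sumset B (insert j K) = {x + y | x y. x \<in> B j \<and> y \<in> sumset B K}"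
    using assms(1-7) eqK by (auto simp: sumset_insert Cp Cj)
  show "sumset C (insert j K) \<subseteq> sumset B (insert j K)"
    unfolding Sj Tj Cj by auto
  show "0 \<in> sumset C (insert j K)" by (rule zero_in_sumset)
  fix z assume z: "z \<in> sumset C (insert p K) - sumset B (insert p K)"
  then obtain b s where b: "z = e + b + s" "b \<in> B j" "s \<in> sumset B K"
    unfolding Sp Tp Cp by auto
  have "z - e \<notin> sumset C (insert j K)"
  proof
    assume "z - e \<in> sumset C (insert j K)"
    then obtain b' s' where "b + s = b' + s'" "e + b' \<in> B p" "s' \<in> sumset B K"
      unfolding Sj Cj using b by auto
    then have "z = (e + b') + s'" using b by simp
    then have "z \<in> sumset B (insert p K)"
      unfolding Tp using \<open>e + b' \<in> B p\<close> \<open>s' \<in> _\<close> by blast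
    with z show False by blast
  qed
  with b show "e \<le> z \<and> z - e \<in> sumset B (insert j K) - sumset C (insert j K)"
    unfolding Tj by auto
qed

text \<open>Swapping \<open>p\<close> and \<open>j\<close> is an involution on the index sets of
  size \<open>r\<close>. Its fixed points contain both or neither of the two indices, and there no
  sumset grows; the other index sets are compared in pairs.\<close>

lemma rank_sum_dyson_transform_le:
  assumes "finite J" "p \<in> J" "j \<in> J" "p \<noteq> j" "0 \<in> B p" "0 \<in> B j" "e \<in> B p"
  shows "rank_sum (dyson_transform p j e B) J r m \<le> rank_sum B J r m"
proof -
  let ?C = "dyson_transform p j e B"
  let ?F = "{I. I \<subseteq> J \<and> card I = r}"
  define s where "s = (\<lambda>I. transpose p j ` I)"
  have s_in: "s I \<in> ?F" if "I \<in> ?F" for I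
  proof -
    have "s I \<subseteq> J" using that assms by (auto simp: s_def transpose_def)
    moreover have "card (s I) = card I"
      unfolding s_def by (rule card_image) (rule inj_on_subset[OF inj_transpose], simp)
    ultimately show ?thesis using that by simp
  qed
  have ss: "s (s I) = I" for I by (auto simp: s_def image_comp)
  \<comment> \<open>Adding to each index set its partner counts everything twice, fixed points
    included, so no representatives of the pairs have to be chosen.\<close>
  have twice: "(\<Sum>I\<in>?F. f I + f (s I)) = 2 * (\<Sum>I\<in>?F. f I)" for f :: "_ \<Rightarrow> nat"
  proof -
    have "(\<Sum>I\<in>?F. f (s I)) = (\<Sum>I\<in>?F. f I)"
      by (rule sum.reindex_bij_witness[where i = s and j = s]) (use s_in ss in auto)
    then show ?thesis by (simp add: sum.distrib)
  qed
  have pair: "counting (sumset ?C I) m + counting (sumset ?C (s I)) m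
      \<le> counting (sumset B I) m + counting (sumset B (s I)) m" if "I \<in> ?F" for I
  proof -
    define K where "K = I - {p, j}"
    have K: "finite K" "p \<notin> K" "j \<notin> K"
      using that assms(1) by (auto simp: K_def intro: finite_subset)
    have sK: "s K = K" using K by (auto simp: s_def transpose_def image_def)
    have sins: "s (insert i L) = insert (transpose p j i) (s L)" for i L
      by (simp add: s_def)
    consider "I = K" | "I = insert p K" | "I = insert j K" | "I = insert p (insert j K)"
      unfolding K_def by blast
    then show ?thesis
    proof cases
      case 1
      have "sumset ?C K = sumset B K"
        using K by (intro sumset_cong) (auto simp: dyson_transform_def)
      then show ?thesis by (simp add: 1 sK)
    next
      case 2
      show ?thesis
        using counting_dyson_transform_one[where B = B, OF K assms(4-7), of m] by (simp add: 2 sins sK)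
    next
      case 3
      show ?thesis
        using counting_dyson_transform_one[where B = B, OF K assms(4-7), of m]
        by (simp add: 3 sins sK)
    next
      case 4
      have "s I = I" by (simp add: 4 sins sK insert_commute)
      moreover have "counting (sumset ?C I) m \<le> counting (sumset B I) m"
        using sumset_dyson_transform_both[where B = B, OF K assms(4-7)]
        by (intro counting_mono) (auto simp: 4)
      ultimately show ?thesis by simp
    qed
  qed
  have "2 * rank_sum ?C J r m \<le> 2 * rank_sum B J r m"
    unfolding rank_sum_def twice[symmetric] by (rule sum_mono) (rule pair)
  then show ?thesis by simp
qed

section \<open>Preservation of the lower bound on the total count\<close>

text \<open>Below \<open>e\<close> the set \<open>B p\<close> alone carries the bound. Take the
  least positive \<open>b\<close> in another set: before \<open>b\<close> only \<open>B p\<close>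
  contributes to the total, and from \<open>b\<close> on \<open>B p\<close> contains its own initial
  part translated by \<open>b\<close>, to which induction applies.\<close>

lemma counting_ge_below_shift:
  fixes \<gamma> :: real
  assumes J: "finite J" "p \<in> J" and zero: "\<And>i. i \<in> J \<Longrightarrow> 0 \<in> B i" and "\<gamma> \<le> 1"
    and hyp: "\<And>m. m \<le> g \<Longrightarrow> \<gamma> * real m \<le> real (\<Sum>i\<in>J. counting (B i) m)"
    and small: "\<And>a b i. a \<in> B p \<Longrightarrow> a < e \<Longrightarrow> i \<in> J - {p} \<Longrightarrow> b \<in> B i \<Longrightarrow> a + b \<in> B p"
    and "t < e" "t \<le> g"
  shows "\<gamma> * real t \<le> real (counting (B p) t)"
  using \<open>t < e\<close> \<open>t \<le> g\<close>
proof (induction t rule: less_induct)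
  case (less t)
  define Q where "Q = (\<lambda>b. 0 < b \<and> (\<exists>i\<in>J - {p}. b \<in> B i))"
  have only_p: "\<gamma> * real m \<le> real (counting (B p) m)" if "m \<le> g" "\<And>b. Q b \<Longrightarrow> m < b" for m
  proof -
    have "counting (B i) m = 0" if "i \<in> J - {p}" for i
    proof -
      have "a \<notin> B i" if "1 \<le> a" "a \<le> m" for a
        using \<open>Q a \<Longrightarrow> m < a\<close> that \<open>i \<in> J - {p}\<close> by (auto simp: Q_def)
      then have "{a \<in> B i. 1 \<le> a \<and> a \<le> m} = {}" by blast
      then show ?thesis by (simp add: counting_def)
    qed
    then have "(\<Sum>i\<in>J. counting (B i) m) = counting (B p) m"
      using J by (subst sum.remove[of J p]) auto
    then show ?thesis using hyp[OF that(1)] by simp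
  qed
  show ?case
  proof (cases "\<exists>b\<le>t. Q b")
    case False
    then show ?thesis using less.prems by (intro only_p) (auto simp: not_le)
  next
    case True
    define b where "b = (LEAST b. Q b)"
    have b: "Q b" "b \<le> t" and b_least: "\<And>c. Q c \<Longrightarrow> b \<le> c"
      using True unfolding b_def by (auto intro: LeastI Least_le order_trans)
    have "0 < b" using b(1) by (simp add: Q_def)
    have "\<gamma> * real (b - 1) \<le> real (counting (B p) (b - 1))"
    proof (rule only_p)
      fix c assume "Q c"
      then show "b - 1 < c" using b_least[of c] \<open>0 < b\<close> by linarith
    qed (use b less.prems in simp)
    moreover have "\<gamma> * real (t - b) \<le> real (counting (B p) (t - b))"
      using b \<open>0 < b\<close> less.prems by (intro less.IH) auto
    moreover have "counting (B p) (b - 1) + 1 + counting (B p) (t - b) \<le> counting (B p) (b + (t - b))"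
    proof (rule counting_superadd)
      fix a assume "a \<in> B p" "a \<le> t - b"
      moreover from b obtain i where "i \<in> J - {p}" "b \<in> B i" by (auto simp: Q_def)
      ultimately show "a + b \<in> B p"
        using b less.prems by (intro small[of a i b]) auto
    qed (use zero J \<open>0 < b\<close> in auto)
    \<comment> \<open>The middle term \<gamma> is paid for by the element \<open>b\<close>, worth 1;
      this is where \<open>\<gamma> \<le> 1\<close> enters.\<close>
    moreover have "\<gamma> * real t = \<gamma> * real (b - 1) + \<gamma> + \<gamma> * real (t - b)"
      using b \<open>0 < b\<close> by (simp add: of_nat_diff algebra_simps)
    ultimately show ?thesis using \<open>\<gamma> \<le> 1\<close> b(2) by simp
  qed
qed

text \<open>The total up to \<open>m\<close> can drop only through elements moved beyond
  \<open>m\<close>. If \<open>b\<close> is the least of these, the old total up to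
  \<open>b - 1\<close> is still available, and the elements of \<open>B p\<close> from
  \<open>b\<close> to \<open>m\<close> make up for the rest.\<close>

lemma dyson_transform_sum_counting_ge:
  fixes \<gamma> :: real
  assumes J: "finite J" "p \<in> J" "j \<in> J" "p \<noteq> j" and zero: "\<And>i. i \<in> J \<Longrightarrow> 0 \<in> B i"
    and "\<gamma> \<le> 1" "e \<in> B p"
    and hyp: "\<And>m. m \<le> g \<Longrightarrow> \<gamma> * real m \<le> real (\<Sum>i\<in>J. counting (B i) m)"
    and small: "\<And>a b i. a \<in> B p \<Longrightarrow> a < e \<Longrightarrow> i \<in> J - {p} \<Longrightarrow> b \<in> B i \<Longrightarrow> a + b \<in> B p"
    and "m \<le> g"
  shows "\<gamma> * real m \<le> real (\<Sum>i\<in>J. counting (dyson_transform p j e B i) m)"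
proof -
  let ?C = "dyson_transform p j e B"
  have Cp: "?C p = B p \<union> (+) e ` B j" and Cj: "?C j = {b \<in> B j. e + b \<in> B p}"
    using J by (auto simp: dyson_transform_def)
  have split: "(\<Sum>i\<in>J. counting (D i) m)
      = counting (D p) m + counting (D j) m + (\<Sum>i\<in>J - {p, j}. counting (D i) m)"
    for D :: "_ \<Rightarrow> nat set" and m
  proof -
    have "J - {p, j} = J - {p} - {j}" by auto
    then show ?thesis
      using J sum.remove[of J p "\<lambda>i. counting (D i) m"]
        sum.remove[of "J - {p}" j "\<lambda>i. counting (D i) m"] by simp
  qed
  have rest: "(\<Sum>i\<in>J - {p, j}. counting (?C i) m) = (\<Sum>i\<in>J - {p, j}. counting (B i) m)"
    by (intro sum.cong) (auto simp: dyson_transform_def)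
  define Q where "Q = (\<lambda>b. b \<in> B j \<and> e + b \<notin> B p \<and> m < e + b)"
  \<comment> \<open>Elements of \<open>B j\<close> up to \<open>k\<close> stay or land in
    \<open>B p\<close> at most at \<open>m\<close>. Below, \<open>k\<close> is \<open>m\<close> if
    nothing escapes and \<open>b - 1\<close> otherwise.\<close>
  have moved: "counting (B p) m + counting (B j) k \<le> counting (?C p) m + counting (?C j) m"
    if "k \<le> m" "\<And>c. Q c \<Longrightarrow> k < c" for k
  proof -
    have "counting (B j - ?C j) k \<le> counting (?C p - B p) m"
      unfolding counting_def
    proof (rule card_inj_on_le[where f = "(+) e"])
      show "(+) e ` {a \<in> B j - ?C j. 1 \<le> a \<and> a \<le> k} \<subseteq> {a \<in> ?C p - B p. 1 \<le> a \<and> a \<le> m}"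
      proof
        fix x assume "x \<in> (+) e ` {a \<in> B j - ?C j. 1 \<le> a \<and> a \<le> k}"
        then obtain c where c: "x = e + c" "c \<in> B j" "e + c \<notin> B p" "1 \<le> c" "c \<le> k"
          by (auto simp: Cj)
        then have "\<not> Q c" using that(2)[of c] by auto
        with c show "x \<in> {a \<in> ?C p - B p. 1 \<le> a \<and> a \<le> m}"
          by (auto simp: Cp Q_def)
      qed
    qed (rule inj_on_add, rule finite_counting)
    moreover have "counting (B j) k = counting (?C j) k + counting (B j - ?C j) k"
      by (rule counting_Diff) (auto simp: Cj)
    moreover have "counting (?C p) m = counting (B p) m + counting (?C p - B p) m"
      by (rule counting_Diff) (auto simp: Cp)
    moreover have "counting (?C j) k \<le> counting (?C j) m"
      using that(1) by (rule counting_mono_bound)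
    ultimately show ?thesis by simp
  qed
  show ?thesis
  proof (cases "\<exists>b\<le>m. Q b")
    case False
    then have "counting (B p) m + counting (B j) m \<le> counting (?C p) m + counting (?C j) m"
      by (intro moved) (auto simp: not_le)
    then have "(\<Sum>i\<in>J. counting (B i) m) \<le> (\<Sum>i\<in>J. counting (?C i) m)"
      unfolding split rest by simp
    then show ?thesis using hyp[OF \<open>m \<le> g\<close>] by linarith
  next
    case True
    define b where "b = (LEAST b. Q b)"
    have b: "Q b" "b \<le> m" and b_least: "\<And>c. Q c \<Longrightarrow> b \<le> c"
      using True unfolding b_def by (auto intro: LeastI Least_le order_trans)
    \<comment> \<open>The element 0 never moves, since \<open>e + 0\<close> is in
      \<open>B p\<close>.\<close>
    have "0 < b" using b(1) \<open>e \<in> B p\<close> by (cases b) (auto simp: Q_def)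
    define t where "t = m - b"
    \<comment> \<open>From \<open>m < e + b\<close> follows \<open>t < e\<close>, which makes
      \<open>small\<close> and the bound for \<open>B p\<close> below \<open>e\<close>
      applicable.\<close>
    have t: "t < e" "t \<le> g" "m = b + t"
      using b \<open>m \<le> g\<close> by (auto simp: t_def Q_def)
    have "counting (B p) (b - 1) + 1 + counting (B p) t \<le> counting (B p) m"
      unfolding t(3)
    proof (rule counting_superadd)
      fix a assume "a \<in> B p" "a \<le> t"
      then show "a + b \<in> B p" using small[of a j b] J b t by (auto simp: Q_def)
    qed (use zero J \<open>0 < b\<close> in auto)
    moreover have "\<gamma> * real t \<le> real (counting (B p) t)"
      by (rule counting_ge_below_shift[where B = B and g = g and e = e, OF J(1,2) zero \<open>\<gamma> \<le> 1\<close> hyp small t(1,2)])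
    moreover have "counting (B p) m + counting (B j) (b - 1) \<le> counting (?C p) m + counting (?C j) m"
    proof (rule moved)
      fix c assume "Q c"
      then show "b - 1 < c" using b_least[of c] \<open>0 < b\<close> by linarith
    qed (use b in simp)
    moreover have "(\<Sum>i\<in>J - {p, j}. counting (B i) (b - 1)) \<le> (\<Sum>i\<in>J - {p, j}. counting (B i) m)"
      using b by (intro sum_mono counting_mono_bound) simp
    moreover have "\<gamma> * real (b - 1) \<le> real (\<Sum>i\<in>J. counting (B i) (b - 1))"
      using b \<open>m \<le> g\<close> by (intro hyp) auto
    moreover have "\<gamma> * real m = \<gamma> * real (b - 1) + \<gamma> + \<gamma> * real t"
      using b \<open>0 < b\<close> t(3) by (simp add: of_nat_diff algebra_simps)
    ultimately show ?thesis using \<open>\<gamma> \<le> 1\<close> unfolding split rest by linarith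
  qed
qed

section \<open>The final configuration and the induction towards it\<close>

text \<open>Only index sets containing \<open>p\<close> contribute, each the count of
  \<open>B p\<close>; they arise by choosing the other \<open>r - 1\<close> indices from
  \<open>J - {p}\<close>.\<close>

lemma rank_sum_concentrated:
  assumes J: "finite J" "p \<in> J" and triv: "\<And>i. i \<in> J - {p} \<Longrightarrow> B i = {0}" and "0 \<in> B p" "1 \<le> r"
  shows "rank_sum B J r m = ((card J - 1) choose (r - 1)) * counting (B p) m"
proof -
  let ?F = "{I. I \<subseteq> J \<and> card I = r}"
  let ?G = "{K. K \<subseteq> J - {p} \<and> card K = r - 1}"
  have finF: "finite ?F" using J by simp
  have zero: "sumset B K = {0}" if "K \<subseteq> J - {p}" for K
    using that triv unfolding sumset_def by (auto intro!: sum.neutral exI[of _ "\<lambda>_. 0"])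
  have "rank_sum B J r m = (\<Sum>I\<in>?F. if p \<in> I then counting (B p) m else 0)"
    unfolding rank_sum_def
  proof (rule sum.cong[OF refl])
    fix I assume I: "I \<in> ?F"
    show "counting (sumset B I) m = (if p \<in> I then counting (B p) m else 0)"
    proof (cases "p \<in> I")
      case True
      have K: "finite (I - {p})" "I - {p} \<subseteq> J - {p}"
        using I J by (auto intro: finite_subset)
      have "sumset B (insert p (I - {p})) = B p"
        using K(1) assms(4) by (subst sumset_insert) (auto simp: zero[OF K(2)])
      with True show ?thesis by (simp add: insert_absorb)
    next
      case False
      with I have "sumset B I = {0}" by (intro zero) auto
      with False show ?thesis by (auto simp: counting_def)
    qed
  qed
  also have "\<dots> = card {I \<in> ?F. p \<in> I} * counting (B p) m"
    using finF by (simp add: sum.inter_filter[symmetric])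
  also have "{I \<in> ?F. p \<in> I} = insert p ` ?G"
  proof (intro equalityI subsetI)
    fix I assume I: "I \<in> {I \<in> ?F. p \<in> I}"
    then have "I = insert p (I - {p})" "I - {p} \<in> ?G" by auto
    then show "I \<in> insert p ` ?G" by blast
  next
    fix I assume "I \<in> insert p ` ?G"
    then obtain K where K: "I = insert p K" "K \<subseteq> J - {p}" "card K = r - 1" by auto
    then have "finite K" "p \<notin> K" using J by (auto intro: finite_subset)
    with K J \<open>1 \<le> r\<close> show "I \<in> {I \<in> ?F. p \<in> I}" by auto
  qed
  also have "card (insert p ` ?G) = card ?G"
    by (rule card_image) (auto intro!: inj_onI)
  also have "\<dots> = (card J - 1) choose (r - 1)"
    using J n_subsets[of "J - {p}" "r - 1"] by simp
  finally show ?thesis .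
qed

text \<open>Each transform removes at least one element from the sets other than \<open>B p\<close>,
  so induction on their total size ends at the configuration in which those sets are
  \<open>{0}\<close>.\<close>

lemma rank_sum_ge:
  fixes \<gamma> :: real
  assumes J: "finite J" "p \<in> J" and "\<gamma> \<le> 1" "1 \<le> r" "m \<le> g"
    and "\<And>i. i \<in> J \<Longrightarrow> 0 \<in> B i" "\<And>i. i \<in> J \<Longrightarrow> finite (B i)"
    and "\<And>m. m \<le> g \<Longrightarrow> \<gamma> * real m \<le> real (\<Sum>i\<in>J. counting (B i) m)"
  shows "real ((card J - 1) choose (r - 1)) * \<gamma> * real m \<le> real (rank_sum B J r m)"
  using assms(6-8)
proof (induction "\<Sum>i\<in>J - {p}. card (B i)" arbitrary: B rule: less_induct)
  case less
  note zero = less.prems(1) and fin = less.prems(2) and hyp = less.prems(3)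
  show ?case
  proof (cases "\<forall>i\<in>J - {p}. B i = {0}")
    case True
    have "(\<Sum>i\<in>J. counting (B i) m) = counting (B p) m"
      using J True by (subst sum.remove[of J p]) (auto simp: counting_def)
    then have "\<gamma> * real m \<le> real (counting (B p) m)"
      using hyp[OF \<open>m \<le> g\<close>] by simp
    moreover have "rank_sum B J r m = ((card J - 1) choose (r - 1)) * counting (B p) m"
      using True zero J assms(4) by (intro rank_sum_concentrated) auto
    ultimately show ?thesis
      by (simp add: mult.assoc mult_left_mono)
  next
    case False
    define Q where "Q = (\<lambda>a. a \<in> B p \<and> (\<exists>i\<in>J - {p}. \<exists>b\<in>B i. a + b \<notin> B p))"
    obtain i where i: "i \<in> J - {p}" "B i \<noteq> {0}" using False by blast
    then obtain b where "b \<in> B i" "b \<noteq> 0" using zero[of i] by blast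
    \<comment> \<open>The largest element of the finite set \<open>B p\<close> plus any positive
      \<open>b\<close> leaves \<open>B p\<close>, so a least \<open>e\<close> exists.\<close>
    moreover have "Max (B p) \<in> B p" using fin zero J by (intro Max_in) auto
    moreover have "Max (B p) + b \<notin> B p"
      using \<open>b \<noteq> 0\<close> Max_ge[OF fin[OF J(2)], of "Max (B p) + b"] by linarith
    ultimately have "Q (Max (B p))" using i unfolding Q_def by blast
    define e where "e = (LEAST a. Q a)"
    have "Q e" and e_least: "\<And>a. a < e \<Longrightarrow> \<not> Q a"
      using \<open>Q (Max (B p))\<close> unfolding e_def by (auto intro: LeastI dest: not_less_Least)
    then obtain j b where e: "e \<in> B p" "j \<in> J" "p \<noteq> j" "b \<in> B j" "e + b \<notin> B p"
      unfolding Q_def by blast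
    let ?C = "dyson_transform p j e B"
    have "(\<Sum>i\<in>J - {p}. card (?C i)) < (\<Sum>i\<in>J - {p}. card (B i))"
    proof (rule sum_strict_mono_ex1)
      show "\<forall>i\<in>J - {p}. card (?C i) \<le> card (B i)"
        using fin by (auto simp: dyson_transform_def intro!: card_mono)
      have "card (?C j) < card (B j)"
        using e fin by (intro psubset_card_mono) (auto simp: dyson_transform_def)
      then show "\<exists>i\<in>J - {p}. card (?C i) < card (B i)" using e by blast
    qed (use J in simp)
    moreover have "0 \<in> ?C i" if "i \<in> J" for i
      using zero[OF that] e by (auto simp: dyson_transform_def)
    moreover have "finite (?C i)" if "i \<in> J" for i
      using fin that e by (auto simp: dyson_transform_def)
    moreover have "\<gamma> * real k \<le> real (\<Sum>i\<in>J. counting (?C i) k)" if "k \<le> g" for k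
    proof (rule dyson_transform_sum_counting_ge[OF J e(2,3) zero \<open>\<gamma> \<le> 1\<close> e(1) hyp _ that])
      fix a b i assume "a \<in> B p" "a < e" "i \<in> J - {p}" "b \<in> B i"
      then show "a + b \<in> B p" using e_least[of a] unfolding Q_def by blast
    qed
    ultimately have "real ((card J - 1) choose (r - 1)) * \<gamma> * real m \<le> real (rank_sum ?C J r m)"
      by (rule less.hyps)
    also have "\<dots> \<le> real (rank_sum B J r m)"
      using rank_sum_dyson_transform_le[where B = B, OF J e(2,3) zero[OF J(2)] zero[OF e(2)] e(1)] by simp
    finally show ?thesis .
  qed
qed

section \<open>Reduction to finite sets containing 0\<close>

theorem theorem4:
  fixes n g :: nat and A :: "nat \<Rightarrow> nat set" and \<gamma> :: real
  assumes "n \<ge> 1"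
    and "\<And>i. i \<in> {1..n} \<Longrightarrow> A i \<subseteq> {0<..}"
    and "g \<ge> 1"
    and "\<And>m. m \<in> {1..g} \<Longrightarrow> real (phi A n 1 m) \<ge> \<gamma> * real m"
  shows "\<forall>m\<in>{1..g}. \<forall>r\<in>{1..n}.
           real (phi A n r m) \<ge> real ((n - 1) choose (r - 1)) * min 1 \<gamma> * real m"
proof (intro ballI)
  fix m r assume m: "m \<in> {1..g}" and r: "r \<in> {1..n}"
  \<comment> \<open>Truncation makes the sets finite without changing counts up to \<open>g\<close>.
    Inserting 0 creates no new sums, as \<open>sumset\<close> admits 0 in every summand.\<close>
  define B where "B = (\<lambda>i. insert 0 (A i \<inter> {..g}))"
  have phi1: "phi A n 1 k = (\<Sum>i\<in>{1..n}. counting (A i) k)" for k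
  proof -
    have "{I. I \<subseteq> {1..n} \<and> card I = 1} = (\<lambda>i. {i}) ` {1..n}"
      by (auto simp: card_1_singleton_iff)
    moreover have "counting (sumset A {i}) k = counting (A i) k" for i
    proof (rule counting_cong)
      have "sumset A {i} = insert 0 (A i)"
        unfolding sumset_def by (auto intro: exI[of _ "\<lambda>_. 0"] exI[of _ "\<lambda>_. x" for x])
      then show "sumset A {i} \<inter> {1..k} = A i \<inter> {1..k}" by auto
    qed
    ultimately show ?thesis
      unfolding phi_def by (simp add: sum.reindex)
  qed
  have "min 1 \<gamma> * real k \<le> real (\<Sum>i\<in>{1..n}. counting (B i) k)" if "k \<le> g" for k
  \<comment> \<open>The hypothesis starts at 1, whereas \<open>rank_sum_ge\<close> asks for the
    bound at 0 too, where it is trivial.\<close>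
  proof (cases "k = 0")
    case False
    have "counting (B i) k = counting (A i) k" for i
      by (rule counting_cong) (use that in \<open>auto simp: B_def\<close>)
    then have "\<gamma> * real k \<le> real (\<Sum>i\<in>{1..n}. counting (B i) k)"
      using assms(4)[of k] phi1[of k] that False by simp
    moreover have "min 1 \<gamma> * real k \<le> \<gamma> * real k"
      by (intro mult_right_mono) auto
    ultimately show ?thesis by linarith
  qed (simp add: sum_nonneg)
  then have "real ((card {1..n} - 1) choose (r - 1)) * min 1 \<gamma> * real m \<le> real (rank_sum B {1..n} r m)"
    using m r assms(1) by (intro rank_sum_ge[where p = 1 and g = g]) (auto simp: B_def)
  moreover have "rank_sum B {1..n} r m \<le> phi A n r m"
    unfolding rank_sum_def phi_def
  proof (intro sum_mono counting_mono)
    fix I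
    have "sumset B I \<subseteq> sumset A I"
      unfolding sumset_def B_def by blast
    then show "sumset B I \<inter> {1..m} \<subseteq> sumset A I" by blast
  qed
  ultimately show "real ((n - 1) choose (r - 1)) * min 1 \<gamma> * real m \<le> real (phi A n r m)"
    by simp
qed

end
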